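(* Let $\mathcal{R}$ be an associative ring with unit $1\neq 0$, let $a\in\mathcal{R}$ and let $\mathcal{S},\mathcal{T}$ be right ideals of $\mathcal{R}$. Then the following statements are equivalent: (1) $a^{(1,2)}_{{\rm rprin}=\mathcal{S},{\rm rann}=\mathcal{T}}$ exists, i.e. there is $x\in\mathcal{R}$ with $axa=a$, $xax=x$, $x\mathcal{R}=\mathcal{S}$ and ${\rm rann}(x)=\mathcal{T}$. (2) $\mathcal{R}=a\mathcal{R}\oplus\mathcal{T}$ and $\mathcal{R}=\mathcal{S}\oplus{\rm rann}(a)$. (3) $\mathcal{R}=a\mathcal{S}\oplus\mathcal{T}$, ${\rm rann}(a)\cap\mathcal{S}=\{0\}$, and $a\mathcal{R}\cap\mathcal{T}=\{0\}$. (4) There exists $x\in\mathcal{S}$ such that $\varphi_{ax}=\rho_{a\mathcal{S},\mathcal{T}}$, ${\rm rann}(a)\cap\mathcal{S}=\{0\}$, and $a\mathcal{R}\cap\mathcal{T}=\{0\}$.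
   Context: Notation: $a\mathcal{R}=\{ar:r\in\mathcal{R}\}$, $a\mathcal{S}=\{as:s\in\mathcal{S}\}$, ${\rm rann}(a)=\{r\in\mathcal{R}:ar=0\}$; $\varphi_a:\mathcal{R}\to\mathcal{R}$ is the additive group endomorphism $\varphi_a(r)=ar$. For additive subgroups $\mathcal{S},\mathcal{T}$ of $\mathcal{R}$, $\mathcal{R}=\mathcal{S}\oplus\mathcal{T}$ means $\mathcal{R}=\mathcal{S}+\mathcal{T}$ and $\mathcal{S}\cap\mathcal{T}=\{0\}$; in that case $\rho_{\mathcal{S},\mathcal{T}}:\mathcal{R}\to\mathcal{R}$ is the group endomorphism $\rho_{\mathcal{S},\mathcal{T}}(s+t)=s$ for $s\in\mathcal{S}$, $t\in\mathcal{T}$. Convention: whenever $\rho_{\mathcal{S},\mathcal{T}}$ is written, it is implicitly asserted that $\mathcal{R}=\mathcal{S}\oplus\mathcal{T}$. *)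

theory Defs
  imports "HOL-Library.Set_Algebras"
begin

text \<open>
  The ring is the whole type, of class \<open>ring_1\<close> (associative, unital, \<open>0 \<noteq> 1\<close>, not necessarily
  commutative). The sets $a\mathcal{S}$ and $\mathcal{S}+\mathcal{T}$ are \<open>a *o S\<close> and \<open>S + T\<close> from
  \<^theory>\<open>HOL-Library.Set_Algebras\<close>.
\<close>

definition right_ideal :: "'a::ring_1 set \<Rightarrow> bool" where
  "right_ideal I \<longleftrightarrow>
     0 \<in> I \<and> (\<forall>x\<in>I. \<forall>y\<in>I. x - y \<in> I) \<and> (\<forall>x\<in>I. \<forall>r. x * r \<in> I)"

definition rann :: "'a::ring_1 \<Rightarrow> 'a set" where
  "rann a = {r. a * r = 0}"

definition phi :: "'a::ring_1 \<Rightarrow> 'a \<Rightarrow> 'a" where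
  "phi a = (\<lambda>r. a * r)"

definition ring_direct_sum :: "'a::ring_1 set \<Rightarrow> 'a set \<Rightarrow> bool" where
  "ring_direct_sum S T \<longleftrightarrow> UNIV = S + T \<and> S \<inter> T = {0}"

text \<open>
  \<open>rho S T\<close> is the projection onto \<open>S\<close> along \<open>T\<close>. It is meaningful only for additive subgroups
  with \<open>ring_direct_sum S T\<close>, which must therefore be asserted wherever \<open>rho\<close> is used.
\<close>

definition rho :: "'a::ring_1 set \<Rightarrow> 'a set \<Rightarrow> 'a \<Rightarrow> 'a" where
  "rho S T r = (THE s. s \<in> S \<and> (\<exists>t\<in>T. r = s + t))"

definition is_12_inverse :: "'a::ring_1 \<Rightarrow> 'a set \<Rightarrow> 'a set \<Rightarrow> 'a \<Rightarrow> bool" where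
  "is_12_inverse a S T x \<longleftrightarrow>
     a * x * a = a \<and> x * a * x = x \<and> x *o UNIV = S \<and> rann x = T"

end

theory Submission
  imports Defs
begin

text \<open>
  Everything rests on splitting the unit. If \<open>\<R> = a\<S> \<oplus> \<T>\<close>, then \<open>1 = a x + t\<close> with
  \<open>x \<in> \<S>\<close> and \<open>t \<in> \<T>\<close>. Multiplying by \<open>r\<close> on the right gives \<open>r = a x r + t r\<close>, and as
  \<open>\<S>\<close> and \<open>\<T>\<close> are right ideals, this is the decomposition of \<open>r\<close> along \<open>a\<S> \<oplus> \<T>\<close>.
  Hence left multiplication by \<open>a x\<close> is the projection onto \<open>a\<S>\<close> along \<open>\<T>\<close>
  (\<open>phi_eq_rho_if_unit_split\<close>). The same \<open>x\<close> is the prescribed inverse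
  (\<open>is_12_inverse_if_unit_split\<close>): its defining properties reduce to the vanishing of certain
  elements, each of which lies in \<open>a\<R> \<inter> \<T>\<close> or in \<open>rann a \<inter> \<S>\<close>.

  Conversely, for a \<open>{1,2}\<close>-inverse \<open>x\<close> the idempotents \<open>a x\<close> and \<open>x a\<close> induce the two Peirce
  decompositions of \<open>\<R>\<close> (\<open>direct_sums_if_is_12_inverse\<close>). Passing between the decompositions
  with \<open>a\<R>\<close> and those with \<open>a\<S>\<close> is harmless since either set of hypotheses forces
  \<open>a\<R> = a\<S>\<close>.
\<close>

lemma right_ideal_mult: "right_ideal I \<Longrightarrow> x \<in> I \<Longrightarrow> x * r \<in> I"
  by (simp add: right_ideal_def)

lemma right_ideal_diff: "right_ideal I \<Longrightarrow> x \<in> I \<Longrightarrow> y \<in> I \<Longrightarrow> x - y \<in> I"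
  by (simp add: right_ideal_def)

lemma right_ideal_zero: "right_ideal I \<Longrightarrow> 0 \<in> I"
  by (simp add: right_ideal_def)

lemma right_ideal_elt_set_times:
  assumes "right_ideal I"
  shows "right_ideal (a *o I)"
  unfolding right_ideal_def
proof (intro conjI ballI allI)
  show "0 \<in> a *o I"
    using set_times_intro2[OF right_ideal_zero[OF assms], of a] by simp
next
  fix x y
  assume "x \<in> a *o I" "y \<in> a *o I"
  then obtain c d where "c \<in> I" "d \<in> I" "x = a * c" "y = a * d"
    by (auto simp: elt_set_times_def)
  then show "x - y \<in> a *o I"
    using right_ideal_diff[OF assms]
    by (simp add: right_diff_distrib[symmetric] set_times_intro2)
next
  fix x r
  assume "x \<in> a *o I"
  then obtain c where "c \<in> I" "x = a * c"
    by (auto simp: elt_set_times_def)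
  then show "x * r \<in> a *o I"
    using right_ideal_mult[OF assms] by (simp add: mult.assoc set_times_intro2)
qed

lemma ring_direct_sumI:
  assumes "\<And>r. \<exists>s\<in>S. r - s \<in> T" and "S \<inter> T = {0}"
  shows "ring_direct_sum S T"
proof -
  have "r \<in> S + T" for r
  proof -
    obtain s where "s \<in> S" "r - s \<in> T"
      using assms(1) by blast
    then show ?thesis
      using set_plus_intro[of s S "r - s" T] by simp
  qed
  with assms(2) show ?thesis
    by (auto simp: ring_direct_sum_def)
qed

lemma ring_direct_sum_decompose:
  assumes "ring_direct_sum S T"
  shows "\<exists>s\<in>S. r - s \<in> T"
proof -
  have "r \<in> S + T"
    using assms by (auto simp: ring_direct_sum_def)
  then obtain s t where "s \<in> S" "t \<in> T" "r = s + t"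
    by (auto elim: set_plus_elim)
  then show ?thesis
    by force
qed

lemma rho_eqI:
  assumes "right_ideal S" and "right_ideal T" and "S \<inter> T = {0}"
    and "s \<in> S" and "r - s \<in> T"
  shows "rho S T r = s"
  unfolding rho_def
proof (rule the_equality)
  show "s \<in> S \<and> (\<exists>t\<in>T. r = s + t)"
    using assms(4,5) by (auto intro!: bexI[of _ "r - s"])
next
  fix s'
  assume "s' \<in> S \<and> (\<exists>t\<in>T. r = s' + t)"
  then have s': "s' \<in> S" "r - s' \<in> T"
    by auto
  have "s' - s \<in> S"
    using assms(1,4) s'(1) by (simp add: right_ideal_diff)
  moreover have "s' - s \<in> T"
    using right_ideal_diff[OF assms(2,5) s'(2)] by simp
  ultimately have "s' - s \<in> S \<inter> T"
    by simp
  then show "s' = s"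
    unfolding assms(3) by simp
qed

text \<open>
  The idempotents \<open>a x\<close> and \<open>x a\<close> split \<open>r\<close> as \<open>a x r + (1 - a x) r\<close> and
  \<open>x a r + (1 - x a) r\<close>; the second terms are killed by \<open>x\<close> and by \<open>a\<close>.
\<close>

lemma direct_sums_if_is_12_inverse:
  assumes "is_12_inverse a S T x"
  shows "ring_direct_sum (a *o UNIV) T" and "ring_direct_sum S (rann a)"
proof -
  have axa: "a * (x * (a * r)) = a * r" and xax: "x * (a * (x * r)) = x * r" for r
    using assms by (simp_all add: is_12_inverse_def mult.assoc[symmetric])
  have S: "S = x *o UNIV" and T: "T = rann x"
    using assms by (auto simp: is_12_inverse_def)
  have disj: "(b *o UNIV) \<inter> rann c = {0}"
    if "\<And>r. b * (c * (b * r)) = b * r" for b c :: 'a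
  proof -
    have "b * r = 0" if "c * (b * r) = 0" for r
      by (metis \<open>\<And>r. b * (c * (b * r)) = b * r\<close> that mult_zero_right)
    moreover have "0 \<in> b *o UNIV"
      using set_times_intro2[of 0 UNIV b] by simp
    ultimately show ?thesis
      by (auto simp: elt_set_times_def rann_def)
  qed
  show "ring_direct_sum (a *o UNIV) T"
    unfolding T
  proof (rule ring_direct_sumI[OF _ disj[OF axa]])
    show "\<exists>s\<in>a *o UNIV. r - s \<in> rann x" for r
      by (rule bexI[of _ "a * (x * r)"])
        (auto simp: rann_def elt_set_times_def right_diff_distrib xax)
  qed
  show "ring_direct_sum S (rann a)"
    unfolding S
  proof (rule ring_direct_sumI[OF _ disj[OF xax]])
    show "\<exists>s\<in>x *o UNIV. r - s \<in> rann a" for r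
      by (rule bexI[of _ "x * (a * r)"])
        (auto simp: rann_def elt_set_times_def right_diff_distrib axa)
  qed
qed

lemma mult_image_eq_if_complements_rann:
  assumes "ring_direct_sum S (rann a)"
  shows "a *o UNIV = a *o S"
proof -
  have "a * r \<in> a *o S" for r
  proof -
    obtain s where "s \<in> S" "r - s \<in> rann a"
      using ring_direct_sum_decompose[OF assms] by blast
    then have "a * r = a * s" "s \<in> S"
      by (simp_all add: rann_def right_diff_distrib)
    then show ?thesis
      by (simp add: set_times_intro2)
  qed
  then show ?thesis
    by (auto simp: elt_set_times_def)
qed

text \<open>
  Write \<open>a r = a s + t\<close>. The remainder \<open>t = a (r - s)\<close> lies in \<open>a\<R> \<inter> \<T>\<close>, so it vanishes.
\<close>

lemma mult_image_eq_if_complemented: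
  assumes "ring_direct_sum (a *o S) T" and "(a *o UNIV) \<inter> T = {0}"
  shows "a *o UNIV = a *o S"
proof -
  have "a * r \<in> a *o S" for r
  proof -
    obtain s where s: "s \<in> S" "a * r - a * s \<in> T"
      using ring_direct_sum_decompose[OF assms(1), of "a * r"]
      by (auto simp: elt_set_times_def)
    moreover have "a * r - a * s \<in> a *o UNIV"
      using set_times_intro2[of "r - s" UNIV a] by (simp add: right_diff_distrib)
    ultimately have "a * r - a * s \<in> (a *o UNIV) \<inter> T"
      by simp
    then have "a * r = a * s"
      unfolding assms(2) by simp
    with s(1) show ?thesis
      by (simp add: set_times_intro2)
  qed
  then show ?thesis
    by (auto simp: elt_set_times_def)
qed

lemma complements_rann_if_mult_image_eq:
  assumes "a *o UNIV = a *o S" and "rann a \<inter> S = {0}"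
  shows "ring_direct_sum S (rann a)"
proof (rule ring_direct_sumI)
  fix r
  have "a * r \<in> a *o S"
    unfolding assms(1)[symmetric] by (simp add: set_times_intro2)
  then obtain s where "s \<in> S" "a * r = a * s"
    by (auto simp: elt_set_times_def)
  then show "\<exists>s\<in>S. r - s \<in> rann a"
    by (auto simp: rann_def right_diff_distrib)
qed (use assms(2) in blast)

lemma unit_split:
  assumes "ring_direct_sum (a *o S) T"
  obtains x where "x \<in> S" and "1 - a * x \<in> T"
  using ring_direct_sum_decompose[OF assms, of 1] by (auto simp: elt_set_times_def)

lemma phi_eq_rho_if_unit_split:
  assumes "right_ideal S" and "right_ideal T" and "(a *o S) \<inter> T = {0}"
    and "x \<in> S" and "1 - a * x \<in> T"
  shows "phi (a * x) = rho (a *o S) T"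
proof
  fix r
  have "rho (a *o S) T r = a * (x * r)"
  proof (rule rho_eqI[OF right_ideal_elt_set_times[OF assms(1)] assms(2,3)])
    show "a * (x * r) \<in> a *o S"
      using assms(1,4) by (simp add: right_ideal_mult set_times_intro2)
    show "r - a * (x * r) \<in> T"
      using right_ideal_mult[OF assms(2,5), of r] by (simp add: left_diff_distrib mult.assoc)
  qed
  then show "phi (a * x) r = rho (a *o S) T r"
    by (simp add: phi_def mult.assoc)
qed

text \<open>
  The two trivial intersections act as cancellation laws: an element of \<open>a\<R>\<close> that lies in \<open>\<T>\<close>
  is zero, and \<open>a\<close> is left cancellable on \<open>\<S>\<close>. The first gives \<open>a x a = a\<close> and, for
  \<open>r \<in> \<T>\<close>, \<open>a x r = 0\<close>. Cancelling \<open>a\<close> turns \<open>a x a s = a s\<close> into \<open>x a s = s\<close> for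
  \<open>s \<in> \<S>\<close>, which contains \<open>x a x = x\<close>, and \<open>a x r = 0\<close> into \<open>x r = 0\<close>.
\<close>

lemma is_12_inverse_if_unit_split:
  assumes S: "right_ideal S" and T: "right_ideal T"
    and disjS: "rann a \<inter> S = {0}" and disjT: "(a *o UNIV) \<inter> T = {0}"
    and x: "x \<in> S" and t: "1 - a * x \<in> T"
  shows "is_12_inverse a S T x"
proof -
  have xS: "x * r \<in> S" and tT: "r - a * (x * r) \<in> T" for r
    using right_ideal_mult[OF S x, of r] right_ideal_mult[OF T t, of r]
    by (simp_all add: left_diff_distrib mult.assoc)
  have zero: "a * r = 0" if "a * r \<in> T" for r
    using that disjT set_times_intro2[of r UNIV a] by auto
  have cancel: "u = v" if "a * u = a * v" "u \<in> S" "v \<in> S" for u v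
  proof -
    have "u - v \<in> rann a \<inter> S"
      using that S by (simp add: rann_def right_diff_distrib right_ideal_diff)
    with disjS show ?thesis
      by auto
  qed
  have axa: "a * (x * a) = a"
    using zero[of "1 - x * a"] tT[of a] by (simp add: right_diff_distrib)
  have xas: "x * (a * s) = s" if "s \<in> S" for s
  proof (rule cancel)
    show "a * (x * (a * s)) = a * s"
      using arg_cong[OF axa, of "\<lambda>b. b * s"] by (simp add: mult.assoc)
  qed (use that xS in auto)
  have "x *o UNIV = S"
    using xS xas[symmetric] by (auto simp: elt_set_times_def)
  moreover have "rann x = T"
  proof (intro equalityI subsetI)
    fix r
    assume "r \<in> rann x"
    then show "r \<in> T"
      using tT[of r] by (simp add: rann_def)
  next
    fix r
    assume r: "r \<in> T"
    have "a * (x * r) \<in> T"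
      using right_ideal_diff[OF T r tT[of r]] by simp
    then have "a * (x * r) = a * 0"
      using zero by simp
    then show "r \<in> rann x"
      using cancel[OF _ xS right_ideal_zero[OF S]] by (simp add: rann_def)
  qed
  ultimately show ?thesis
    using axa xas[OF x] by (simp add: is_12_inverse_def mult.assoc)
qed

theorem theorem6p11:
  fixes a :: "'a::ring_1" and S T :: "'a set"
  assumes "right_ideal S" and "right_ideal T"
  shows
    "((\<exists>x. is_12_inverse a S T x)
       \<longleftrightarrow> ring_direct_sum (a *o UNIV) T \<and> ring_direct_sum S (rann a))
     \<and> (ring_direct_sum (a *o UNIV) T \<and> ring_direct_sum S (rann a)
       \<longleftrightarrow> ring_direct_sum (a *o S) T \<and> rann a \<inter> S = {0} \<and> (a *o UNIV) \<inter> T = {0})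
     \<and> (ring_direct_sum (a *o S) T \<and> rann a \<inter> S = {0} \<and> (a *o UNIV) \<inter> T = {0}
       \<longleftrightarrow> (\<exists>x\<in>S. ring_direct_sum (a *o S) T \<and> phi (a * x) = rho (a *o S) T
              \<and> rann a \<inter> S = {0} \<and> (a *o UNIV) \<inter> T = {0}))"
    (is "(?P1 \<longleftrightarrow> ?P2) \<and> (_ \<longleftrightarrow> ?P3) \<and> (_ \<longleftrightarrow> ?P4)")
proof -
  have "?P2" if "?P1"
    using that direct_sums_if_is_12_inverse by blast
  moreover have "?P3" if "?P2"
  proof -
    have "a *o UNIV = a *o S"
      using that mult_image_eq_if_complements_rann by blast
    with that show ?thesis
      by (auto simp: ring_direct_sum_def Int_commute)
  qed
  moreover have "?P2" if "?P3"
  proof -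
    have eq: "a *o UNIV = a *o S"
      using that mult_image_eq_if_complemented by blast
    then show ?thesis
      using that complements_rann_if_mult_image_eq[OF eq] by simp
  qed
  moreover have "?P1 \<and> ?P4" if P3: "?P3"
  proof -
    obtain x where x: "x \<in> S" "1 - a * x \<in> T"
      using P3 unit_split by blast
    have "(a *o S) \<inter> T = {0}"
      using P3 by (simp add: ring_direct_sum_def)
    then have "phi (a * x) = rho (a *o S) T"
      using phi_eq_rho_if_unit_split[OF assms _ x] by blast
    moreover have "is_12_inverse a S T x"
      using is_12_inverse_if_unit_split[OF assms _ _ x] P3 by blast
    ultimately show ?thesis
      using P3 x(1) by blast
  qed
  moreover have "?P3" if "?P4"
    using that by blast
  ultimately show ?thesis
    by argo
qed

end
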